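(* Let $\mathcal{X}$ be a finite set with $|\mathcal{X}|\ge2$, $(\mathcal{X},\mathcal{E})$ a strongly connected directed graph, $\mathcal{E}^\star=\{(x,x'):(x',x)\in\mathcal{E}\}$, and let $P$ be irreducible over $(\mathcal{X},\mathcal{E})$ with time-reversal $P^\star$. (m-projection) The m-projection $P_m=\arg\min_{\bar P\in\mathcal{W}_{\mathsf{rev}}(\mathcal{X},\mathcal{E}\cup\mathcal{E}^\star)}D(P\|\bar P)$ of $P$ onto $\mathcal{W}_{\mathsf{rev}}(\mathcal{X},\mathcal{E}\cup\mathcal{E}^\star)$ is given by $$P_m=\frac{P+P^\star}{2}.$$ Moreover, for any $\bar P\in\mathcal{W}_{\mathsf{rev}}(\mathcal{X},\mathcal{E}\cup\mathcal{E}^\star)$, $$D(P\|\bar P)=D(P\|P_m)+D(P_m\|\bar P).$$ (e-projection) When $(\mathcal{X},\mathcal{E}\cap\mathcal{E}^\star)$ is a strongly connected directed graph, the e-projection $P_e=\arg\min_{\bar P\in\mathcal{W}_{\mathsf{rev}}(\mathcal{X},\mathcal{E}\cap\mathcal{E}^\star)}D(\bar P\|P)$ of $P$ onto $\mathcal{W}_{\mathsf{rev}}(\mathcal{X},\mathcal{E}\cap\mathcal{E}^\star)$ is given by $$P_e=\mathfrak{s}(\widetilde P_e),\qquad \widetilde P_e(x,x')=\sqrt{P(x,x')P^\star(x,x')}.$$ Moreover, for any $\bar P\in\mathcal{W}_{\mathsf{rev}}(\mathcal{X},\mathcal{E}\cap\mathcal{E}^\star)$, $$D(\bar P\|P)=D(\bar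 P\|P_e)+D(P_e\|P).$$
   Context: For a strongly connected graph $(\mathcal{X},\mathcal{E})$, $P$ is irreducible over $(\mathcal{X},\mathcal{E})$ if it is a row-stochastic matrix on $\mathcal{X}$ with $P(x,x')>0$ exactly for $(x,x')\in\mathcal{E}$. Such $P$ has a unique stationary distribution $\pi>0$; its time-reversal is $P^\star(x,x')=\pi(x')P(x',x)/\pi(x)$; $P$ is reversible if $P=P^\star$. $\mathcal{W}_{\mathsf{rev}}(\mathcal{X},\mathcal{E}')$: reversible kernels irreducible over $(\mathcal{X},\mathcal{E}')$. Information divergence, for $P_k$ irreducible over $(\mathcal{X},\mathcal{E}_k)$ with stationary distribution $\pi_k$, $k=1,2$: $D(P_1\|P_2)=\sum_{(x,x')\in\mathcal{E}_1}\pi_1(x)P_1(x,x')\log\frac{P_1(x,x')}{P_2(x,x')}$ if $\mathcal{E}_1\subset\mathcal{E}_2$, and $+\infty$ otherwise. Stochastic rescaling $\mathfrak{s}$: for a non-negative matrix $\widetilde P$ on $\mathcal{X}$ that is positive exactly on the edges of a strongly connected graph, $\mathfrak{s}(\widetilde P)(x,x')=\frac{\widetilde P(x,x')v(x')}{\rho(\widetilde P)v(x)}$, where $\rho(\widetilde P)$ is the Perron–Frobenius root (spectral radius) and $v>0$ the right Perron–Frobenius eigenvector of $\widetilde P$. *)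

theory Defs
  imports "HOL-Analysis.Analysis"
begin

text \<open>
  The finite state space is the universe of a type \<open>'x::finite\<close>; a kernel is a matrix
  \<open>P :: real^'x^'x\<close> whose entry \<open>P $ x $ x'\<close> is the transition probability from
  \<open>x\<close> to \<open>x'\<close>, and a directed graph is its edge set \<open>E :: ('x \<times> 'x) set\<close> (loops allowed).
\<close>

definition strongly_connected :: "('x \<times> 'x) set \<Rightarrow> bool" where
  "strongly_connected E \<longleftrightarrow> (\<forall>x y. (x, y) \<in> E\<^sup>*)"

definition row_stochastic :: "real^'x^'x \<Rightarrow> bool" where
  "row_stochastic P \<longleftrightarrow> (\<forall>x x'. 0 \<le> P $ x $ x') \<and> (\<forall>x. (\<Sum>x'\<in>UNIV. P $ x $ x') = 1)"

definition edges :: "real^'x^'x \<Rightarrow> ('x \<times> 'x) set" where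
  "edges P = {(x, x'). P $ x $ x' > 0}"

definition irreducible_over :: "('x \<times> 'x) set \<Rightarrow> real^'x^'x \<Rightarrow> bool" where
  "irreducible_over E P \<longleftrightarrow> strongly_connected E \<and> row_stochastic P \<and> edges P = E"

text \<open>Meaningful only when the stationary distribution is unique, as for irreducible kernels.\<close>

definition stationary_distribution :: "real^'x^'x \<Rightarrow> real^'x" where
  "stationary_distribution P =
    (THE p. (\<forall>x. 0 \<le> p $ x) \<and> (\<Sum>x\<in>UNIV. p $ x) = 1 \<and> p v* P = p)"

definition time_reversal :: "real^'x^'x \<Rightarrow> real^'x^'x" where
  "time_reversal P =
    (\<chi> x x'. stationary_distribution P $ x' * P $ x' $ x / stationary_distribution P $ x)"

definition reversible :: "real^'x^'x \<Rightarrow> bool" where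
  "reversible P \<longleftrightarrow> P = time_reversal P"

definition W_rev :: "('x \<times> 'x) set \<Rightarrow> (real^'x^'x) set" where
  "W_rev E = {P. irreducible_over E P \<and> reversible P}"

text \<open>
  The edge set over which a kernel is irreducible is determined by the kernel, so the
  divergence needs no separate graph arguments.
\<close>

definition divergence :: "real^'x^'x \<Rightarrow> real^'x^'x \<Rightarrow> ereal" where
  "divergence P1 P2 =
    (if edges P1 \<subseteq> edges P2
     then ereal (\<Sum>(x, x')\<in>edges P1.
            stationary_distribution P1 $ x * P1 $ x $ x' * ln (P1 $ x $ x' / P2 $ x $ x'))
     else \<infinity>)"

definition eigenvalues :: "real^'x^'x \<Rightarrow> complex set" where
  "eigenvalues A = {l. \<exists>u. u \<noteq> 0 \<and> (\<chi> x x'. complex_of_real (A $ x $ x')) *v u = l *s u}"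

definition pf_root :: "real^'x^'x \<Rightarrow> real" where
  "pf_root A = (SUP l\<in>eigenvalues A. cmod l)"

text \<open>
  A positive right eigenvector for the Perron-Frobenius root is unique only up to a positive
  factor, which cancels in the rescaling.
\<close>

definition pf_eigenvector :: "real^'x^'x \<Rightarrow> real^'x" where
  "pf_eigenvector A = (SOME v. (\<forall>x. 0 < v $ x) \<and> A *v v = pf_root A *s v)"

definition stochastic_rescaling :: "real^'x^'x \<Rightarrow> real^'x^'x" where
  "stochastic_rescaling A =
    (\<chi> x x'. A $ x $ x' * pf_eigenvector A $ x' / (pf_root A * pf_eigenvector A $ x))"

end

theory Submission
  imports Defs
begin

text \<open>
  Under the edge measure \<open>\<pi>(x) P(x,x')\<close> every coboundary \<open>h(x') - h(x)\<close> has expectation \<open>0\<close>, and for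
  reversible \<open>P\<close> so does every antisymmetric function. The edge measure of \<open>P\<^sub>m\<close> is the symmetrization
  of that of \<open>P\<close>, and detailed balance makes the antisymmetric part of \<open>ln (P\<^sub>m / Q)\<close> a coboundary for
  reversible \<open>Q\<close>, so \<open>P\<close> and \<open>P\<^sub>m\<close> give this function the same expectation. Dually,
  \<open>ln (P\<^sub>e / P)\<close> is an antisymmetric function plus a coboundary minus \<open>ln \<rho>\<close>, so
  \<open>D(Q\<parallel>P) - D(Q\<parallel>P\<^sub>e) = - ln \<rho>\<close> for every reversible \<open>Q\<close>, in particular for \<open>Q = P\<^sub>e\<close>. Both
  projections then follow from the positivity of the divergence.
\<close>

section \<open>Perron-Frobenius theory of non-negative matrices\<close>

text \<open>Positivity propagates backwards along edges: if \<open>v $ z\<close> and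
  \<open>A $ x $ z\<close> are positive, then so is \<open>(A *v v) $ x = r * v $ x\<close>. Every
  vertex has a path to one where \<open>v\<close> does not vanish.\<close>

lemma nonneg_eigenvector_pos:
  fixes A :: "real^'x::finite^'x"
  assumes nonneg: "\<And>x y. 0 \<le> A $ x $ y" and conn: "strongly_connected (edges A)"
    and v: "\<And>x. 0 \<le> v $ x" "v \<noteq> 0" and eig: "A *v v = r *s v"
  shows "0 < v $ x"
proof -
  from v(2) obtain y where "v $ y \<noteq> 0"
    by (auto simp: vec_eq_iff)
  with v(1)[of y] have y: "0 < v $ y" by simp
  have "(x, y) \<in> (edges A)\<^sup>*"
    using conn by (simp add: strongly_connected_def)
  then show ?thesis
  proof (induction rule: converse_rtrancl_induct)
    case base
    show ?case by (rule y)
  next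
    case (step x z)
    have "0 < A $ x $ z * v $ z"
      using step by (simp add: edges_def)
    also have "\<dots> \<le> (\<Sum>z\<in>UNIV. A $ x $ z * v $ z)"
      by (rule member_le_sum) (simp_all add: nonneg v)
    also have "\<dots> = r * v $ x"
      using eig by (simp add: vec_eq_iff matrix_vector_mult_def)
    finally show ?case
      using v(1)[of x] by (simp add: zero_less_mult_iff)
  qed
qed

text \<open>Brouwer's theorem for \<open>u \<mapsto> (u + A u) / |u + A u|\<^sub>1\<close> on the probability simplex; adding \<open>u\<close>
  keeps the denominator positive.\<close>

lemma perron_frobenius_exists:
  fixes A :: "real^'x::finite^'x"
  assumes nonneg: "\<And>x y. 0 \<le> A $ x $ y" and conn: "strongly_connected (edges A)"
    and edge: "edges A \<noteq> {}"
  shows "\<exists>r v. 0 < r \<and> (\<forall>x. 0 < v $ x) \<and> (\<Sum>x\<in>UNIV. v $ x) = 1 \<and> A *v v = r *s v"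
proof -
  \<comment> \<open>The probability simplex, cut out of a box by a hyperplane so that compactness
    and convexity are immediate.\<close>
  define S where "S = cbox 0 1 \<inter> {v :: real^'x. 1 \<bullet> v = 1}"
  define s where "s u = (\<Sum>x\<in>UNIV. (A *v u) $ x)" for u
  define f where "f u = (1 / (1 + s u)) *\<^sub>R (u + A *v u)" for u
  have S_iff: "u \<in> S \<longleftrightarrow> (\<forall>x. 0 \<le> u $ x) \<and> (\<Sum>x\<in>UNIV. u $ x) = 1" for u
  proof -
    have "u $ x \<le> 1" if "\<forall>x. 0 \<le> u $ x" "(\<Sum>x\<in>UNIV. u $ x) = 1" for x
      using member_le_sum[of x UNIV "\<lambda>x. u $ x"] that by simp
    then show ?thesis
      by (auto simp: S_def mem_box_cart inner_vec_def)
  qed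
  have mult_nonneg: "0 \<le> (A *v u) $ x" if "u \<in> S" for u x
    using that nonneg by (auto simp: S_iff matrix_vector_mult_def intro!: sum_nonneg)
  then have s_nonneg: "0 \<le> s u" if "u \<in> S" for u
    using that by (auto simp: s_def intro: sum_nonneg)
  have "compact S"
    unfolding S_def by (intro compact_Int_closed compact_cbox closed_hyperplane)
  moreover have "convex S"
    unfolding S_def by (intro convex_Int convex_box convex_hyperplane)
  moreover have "S \<noteq> {}"
  proof -
    have "(\<chi> x. 1 / real CARD('x)) \<in> S" by (simp add: S_iff)
    then show ?thesis by blast
  qed
  moreover have "continuous_on S f"
  proof -
    have "continuous_on S s"
      unfolding s_def matrix_vector_mult_def by (auto intro!: continuous_intros)
    moreover have "\<forall>u\<in>S. 1 + s u \<noteq> 0"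
      using s_nonneg by force
    ultimately show ?thesis
      unfolding f_def
      by (intro continuous_intros matrix_vector_mult_linear_continuous_on) auto
  qed
  moreover have "f \<in> S \<rightarrow> S"
  proof
    fix u assume u: "u \<in> S"
    have "(\<Sum>x\<in>UNIV. f u $ x) = (1 / (1 + s u)) * (\<Sum>x\<in>UNIV. u $ x + (A *v u) $ x)"
      by (simp add: f_def sum_distrib_left sum_divide_distrib)
    also have "\<dots> = 1"
      using u s_nonneg[OF u] by (simp add: sum.distrib S_iff flip: s_def)
    finally show "f u \<in> S"
      using u s_nonneg[OF u] mult_nonneg[OF u] by (auto simp: S_iff f_def)
  qed
  ultimately obtain v where v: "v \<in> S" "f v = v"
    by (rule brouwer)
  \<comment> \<open>Clearing the denominator in the fixed-point equation leaves
    \<open>(1 + s v) v = v + A v\<close>, so the normalizing constant yields the eigenvalue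
    \<open>s v\<close>.\<close>
  have "(1 + s v) *\<^sub>R f v = v + A *v v"
    using s_nonneg[OF v(1)] by (simp add: f_def)
  then have eig: "A *v v = s v *s v"
    using v(2) by (simp add: scaleR_add_left scalar_mult_eq_scaleR)
  have "v \<noteq> 0"
    using v(1) by (auto simp: S_iff)
  then have pos: "0 < v $ x" for x
    using nonneg_eigenvector_pos[OF nonneg conn _ _ eig] v(1) by (simp add: S_iff)
  obtain a b where ab: "(a, b) \<in> edges A"
    using edge by auto
  have "0 < A $ a $ b * v $ b"
    using ab pos by (simp add: edges_def)
  also have "\<dots> \<le> (\<Sum>b\<in>UNIV. A $ a $ b * v $ b)"
    by (rule member_le_sum) (simp_all add: nonneg pos less_imp_le)
  also have "\<dots> = s v * v $ a"
    using eig by (simp add: vec_eq_iff matrix_vector_mult_def)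
  finally have "0 < s v"
    using pos[of a] by (simp add: zero_less_mult_iff)
  then show ?thesis
    using pos eig v(1) S_iff by blast
qed

text \<open>The positive eigenvector dominates every complex one: at a point where
  \<open>cmod (u $ x) / v $ x\<close> is maximal, the triangle inequality in the eigenvalue equation
  of \<open>u\<close> gives \<open>cmod l \<le> r\<close>. The value \<open>r\<close> itself is
  attained by \<open>v\<close>.\<close>

lemma pf_root_eq:
  fixes A :: "real^'x::finite^'x"
  assumes nonneg: "\<And>x y. 0 \<le> A $ x $ y" and r: "0 \<le> r"
    and v: "\<And>x. 0 < v $ x" and eig: "A *v v = r *s v"
  shows "pf_root A = r"
  unfolding pf_root_def
proof (rule cSup_eq_maximum)
  have "(\<chi> x. complex_of_real (v $ x)) \<noteq> 0"
    using v by (force simp: vec_eq_iff)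
  moreover have "(\<chi> x y. complex_of_real (A $ x $ y)) *v (\<chi> x. complex_of_real (v $ x)) =
      complex_of_real r *s (\<chi> x. complex_of_real (v $ x))"
    using eig by (simp add: vec_eq_iff matrix_vector_mult_def flip: of_real_mult of_real_sum)
  ultimately have "complex_of_real r \<in> eigenvalues A"
    by (auto simp: eigenvalues_def)
  then show "r \<in> cmod ` eigenvalues A"
    using r by (force simp: image_iff)
next
  fix c assume "c \<in> cmod ` eigenvalues A"
  then obtain l u where c: "c = cmod l" and u: "u \<noteq> 0"
    and lu: "(\<chi> x y. complex_of_real (A $ x $ y)) *v u = l *s u"
    by (auto simp: eigenvalues_def)
  define M where "M = Max (range (\<lambda>x. cmod (u $ x) / v $ x))"
  have M_ge: "cmod (u $ x) \<le> M * v $ x" for x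
  proof -
    have "cmod (u $ x) / v $ x \<le> M" by (simp add: M_def)
    then show ?thesis using v[of x] by (simp add: field_simps)
  qed
  have "M \<in> range (\<lambda>x. cmod (u $ x) / v $ x)"
    unfolding M_def by (rule Max_in) auto
  then obtain x where "M = cmod (u $ x) / v $ x"
    by blast
  then have x: "cmod (u $ x) = M * v $ x"
    using v[of x] by simp
  obtain y where "u $ y \<noteq> 0"
    using u by (auto simp: vec_eq_iff)
  then have "0 < M * v $ y"
    using M_ge[of y] by (meson less_le_trans zero_less_norm_iff)
  then have M_pos: "0 < M"
    using v[of y] by (simp add: zero_less_mult_iff)
  have "cmod l * (M * v $ x) = cmod ((l *s u) $ x)"
    by (simp add: norm_mult x)
  also have "\<dots> = cmod (\<Sum>z\<in>UNIV. complex_of_real (A $ x $ z) * u $ z)"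
    by (simp flip: lu add: matrix_vector_mult_def)
  also have "\<dots> \<le> (\<Sum>z\<in>UNIV. A $ x $ z * (M * v $ z))"
    by (intro order_trans[OF norm_sum] sum_mono)
      (simp add: norm_mult nonneg M_ge mult_left_mono)
  also have "\<dots> = M * (A *v v) $ x"
    by (simp add: matrix_vector_mult_def sum_distrib_left algebra_simps)
  also have "\<dots> = r * (M * v $ x)"
    by (simp add: eig)
  finally show "c \<le> r"
    using M_pos v[of x] by (simp add: c)
qed

text \<open>\<open>perron_frobenius_exists\<close> supplies a positive eigenvector and
  \<open>pf_root_eq\<close> identifies its eigenvalue, so the description under \<open>SOME\<close>
  is satisfiable.\<close>

lemma pf_eigenvector:
  fixes A :: "real^'x::finite^'x"
  assumes "\<And>x y. 0 \<le> A $ x $ y" "strongly_connected (edges A)" "edges A \<noteq> {}"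
  shows "0 < pf_root A" "0 < pf_eigenvector A $ x"
    "A *v pf_eigenvector A = pf_root A *s pf_eigenvector A"
proof -
  obtain r v where r: "0 < r" and v: "\<And>x. 0 < v $ x" "A *v v = r *s v"
    using perron_frobenius_exists[OF assms] by blast
  have root: "pf_root A = r"
    using pf_root_eq[of A r v] assms(1) r v by simp
  then have "(\<forall>x. 0 < v $ x) \<and> A *v v = pf_root A *s v"
    using v by simp
  then have "(\<forall>x. 0 < pf_eigenvector A $ x) \<and>
      A *v pf_eigenvector A = pf_root A *s pf_eigenvector A"
    unfolding pf_eigenvector_def by (rule someI)
  then show "0 < pf_root A" "0 < pf_eigenvector A $ x"
    "A *v pf_eigenvector A = pf_root A *s pf_eigenvector A"
    using r root by auto
qed

section \<open>Stationary distributions of irreducible kernels\<close>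

lemma irreducible_overD:
  assumes "irreducible_over E P"
  shows "strongly_connected E" "0 \<le> P $ x $ y" "(\<Sum>y\<in>UNIV. P $ x $ y) = 1" "edges P = E"
    "0 < P $ x $ y \<longleftrightarrow> (x, y) \<in> E"
  using assms by (auto simp: irreducible_over_def row_stochastic_def edges_def)

lemma strongly_connected_converse: "strongly_connected E \<Longrightarrow> strongly_connected (E\<inverse>)"
  by (simp add: strongly_connected_def rtrancl_converse)

lemma edges_transpose: "edges (transpose P) = (edges P)\<inverse>"
  by (auto simp: edges_def transpose_def)

text \<open>The property under \<open>THE\<close> in \<open>stationary_distribution\<close>, named
  so that existence and uniqueness can be treated separately.\<close>

definition stationary :: "real^'x^'x \<Rightarrow> real^'x \<Rightarrow> bool" where
  "stationary P p \<longleftrightarrow> (\<forall>x. 0 \<le> p $ x) \<and> (\<Sum>x\<in>UNIV. p $ x) = 1 \<and> p v* P = p"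

text \<open>A stationary vector is a right eigenvector of the transpose for eigenvalue
  \<open>1\<close>, and reversing all edges preserves strong connectivity.\<close>

lemma stationary_pos:
  assumes P: "irreducible_over E P" and "stationary P p"
  shows "0 < p $ x"
proof (rule nonneg_eigenvector_pos)
  show "strongly_connected (edges (transpose P))"
    using irreducible_overD[OF P] by (simp add: edges_transpose strongly_connected_converse)
  show "p \<noteq> 0"
    using assms(2) by (auto simp: stationary_def)
  show "transpose P *v p = 1 *s p"
    using assms(2) by (simp add: stationary_def)
qed (use assms in \<open>auto simp: stationary_def transpose_def irreducible_overD(2)\<close>)

text \<open>A normalized Perron-Frobenius eigenvector of the transpose works: summing its eigenvalue
  equation over all states and using the row sums of \<open>P\<close> forces the eigenvalue to be
  \<open>1\<close>.\<close>

lemma stationary_exists: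
  fixes P :: "real^'x::finite^'x"
  assumes P: "irreducible_over E P"
  shows "\<exists>p. stationary P p"
proof -
  note D = irreducible_overD[OF P]
  have "E \<noteq> {}"
  proof
    assume "E = {}"
    then have "P $ x $ y = 0" for x y
      using D(2)[of x y] D(5)[of x y] by simp
    then show False using D(3) by simp
  qed
  then have "edges (transpose P) \<noteq> {}" "strongly_connected (edges (transpose P))"
    using D by (auto simp: edges_transpose strongly_connected_converse)
  moreover have "0 \<le> transpose P $ x $ y" for x y
    by (simp add: transpose_def D)
  ultimately obtain r p where p: "\<And>x. 0 < p $ x" "(\<Sum>x\<in>UNIV. p $ x) = 1"
      "transpose P *v p = r *s p"
    using perron_frobenius_exists[of "transpose P"] by blast
  have "r = (\<Sum>x\<in>UNIV. (r *s p) $ x)"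
    by (simp add: p flip: sum_distrib_left)
  also have "\<dots> = (\<Sum>x\<in>UNIV. \<Sum>y\<in>UNIV. P $ y $ x * p $ y)"
    by (simp flip: p(3) add: matrix_vector_mult_def transpose_def)
  also have "\<dots> = (\<Sum>y\<in>UNIV. (\<Sum>x\<in>UNIV. P $ y $ x) * p $ y)"
    by (subst sum.swap) (simp add: sum_distrib_right)
  also have "\<dots> = 1"
    by (simp add: D p)
  finally have "stationary P p"
    using p by (simp add: stationary_def less_imp_le)
  then show ?thesis ..
qed

text \<open>Subtract from \<open>p\<close> the largest multiple \<open>t\<close> of \<open>q\<close>
  that keeps the difference non-negative. The difference is invariant and has a zero entry, so by
  \<open>nonneg_eigenvector_pos\<close> it vanishes; normalization then gives
  \<open>t = 1\<close>.\<close>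

lemma stationary_unique:
  fixes P :: "real^'x::finite^'x"
  assumes P: "irreducible_over E P" and p: "stationary P p" and q: "stationary P q"
  shows "p = q"
proof -
  note D = irreducible_overD[OF P]
  define t where "t = Min (range (\<lambda>x. p $ x / q $ x))"
  define d where "d = p - t *s q"
  have q_pos: "0 < q $ x" for x
    using P q by (rule stationary_pos)
  have nonneg: "0 \<le> d $ x" for x
  proof -
    have "t \<le> p $ x / q $ x" by (simp add: t_def)
    then show ?thesis using q_pos[of x] by (simp add: d_def field_simps)
  qed
  have "t \<in> range (\<lambda>x. p $ x / q $ x)"
    unfolding t_def by (rule Min_in) auto
  then obtain x where "t = p $ x / q $ x"
    by blast
  then have x: "d $ x = 0"
    using q_pos[of x] by (simp add: d_def)
  have "transpose P *v d = 1 *s d"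
    using p q by (simp add: stationary_def d_def matrix_vector_mult_diff_distrib vector_scalar_commute)
  moreover have "strongly_connected (edges (transpose P))"
    using D by (simp add: edges_transpose strongly_connected_converse)
  moreover have "0 \<le> transpose P $ x $ y" for x y
    by (simp add: transpose_def D)
  ultimately have "d = 0"
    using nonneg_eigenvector_pos[of "transpose P" d 1 x] nonneg x by auto
  then have pq: "p = t *s q"
    by (simp add: d_def)
  then have "1 = t * (\<Sum>x\<in>UNIV. q $ x)"
    using p by (simp add: stationary_def sum_distrib_left)
  with pq q show ?thesis
    by (simp add: stationary_def)
qed

lemma stationary_distribution_eqI:
  fixes P :: "real^'x::finite^'x"
  assumes "irreducible_over E P" "stationary P p"
  shows "stationary_distribution P = p"
  unfolding stationary_distribution_def stationary_def[symmetric]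
  using assms stationary_unique by blast

lemma stationary_stationary_distribution:
  fixes P :: "real^'x::finite^'x"
  assumes "irreducible_over E P"
  shows "stationary P (stationary_distribution P)"
  using stationary_exists[OF assms] stationary_distribution_eqI[OF assms] by metis

lemma stationary_distribution:
  fixes P :: "real^'x::finite^'x"
  assumes "irreducible_over E P"
  shows "0 < stationary_distribution P $ x"
    "(\<Sum>x\<in>UNIV. stationary_distribution P $ x) = 1"
    "(\<Sum>y\<in>UNIV. stationary_distribution P $ y * P $ y $ x) = stationary_distribution P $ x"
  using stationary_pos[OF assms] stationary_stationary_distribution[OF assms]
  by (auto simp: stationary_def vector_matrix_mult_def vec_eq_iff mult.commute)

section \<open>Detailed balance and reversibility\<close>

text \<open>Summing detailed balance over one variable gives invariance of \<open>m\<close>.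
  Allowing an unnormalized weight lets the e-projection be handled without computing its normalizing
  constant.\<close>

lemma stationary_of_detailed_balance:
  fixes P :: "real^'x::finite^'x"
  assumes P: "irreducible_over E P" and m: "\<And>x. 0 < m x"
    and balance: "\<And>x y. m x * P $ x $ y = m y * P $ y $ x"
  shows "stationary_distribution P $ x = m x / (\<Sum>x\<in>UNIV. m x)"
proof -
  define Z where "Z = (\<Sum>x\<in>UNIV. m x)"
  have "0 < Z"
    unfolding Z_def by (rule sum_pos) (simp_all add: m)
  have "(\<Sum>x\<in>UNIV. m x * P $ x $ y) = m y" for y
    by (subst balance) (simp flip: sum_distrib_left add: irreducible_overD[OF P])
  then have "stationary P (\<chi> x. m x / Z)"
    using m \<open>0 < Z\<close>
    by (simp add: stationary_def vec_eq_iff vector_matrix_mult_def less_imp_le Z_def mult.commute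
        flip: sum_divide_distrib)
  then show ?thesis
    by (simp add: stationary_distribution_eqI[OF P] Z_def)
qed

lemma reversible_iff_detailed_balance:
  fixes P :: "real^'x::finite^'x"
  assumes P: "irreducible_over E P"
  shows "reversible P \<longleftrightarrow> (\<forall>x y. stationary_distribution P $ x * P $ x $ y =
      stationary_distribution P $ y * P $ y $ x)"
proof -
  have "a = b / stationary_distribution P $ x \<longleftrightarrow> stationary_distribution P $ x * a = b" for a b x
    using stationary_distribution(1)[OF P, of x] by (auto simp: field_simps)
  then show ?thesis
    by (simp add: reversible_def time_reversal_def vec_eq_iff)
qed

lemma W_revI:
  fixes P :: "real^'x::finite^'x"
  assumes P: "irreducible_over E P" and m: "\<And>x. 0 < m x"
    and balance: "\<And>x y. m x * P $ x $ y = m y * P $ y $ x"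
  shows "P \<in> W_rev E"
proof -
  have "stationary_distribution P $ x = m x / (\<Sum>x\<in>UNIV. m x)" for x
    using assms by (rule stationary_of_detailed_balance)
  then have "reversible P"
    using balance by (simp add: reversible_iff_detailed_balance[OF P])
  with P show ?thesis
    by (simp add: W_rev_def)
qed

lemma W_revD:
  fixes P :: "real^'x::finite^'x"
  assumes "P \<in> W_rev E"
  shows "irreducible_over E P"
    "stationary_distribution P $ x * P $ x $ y = stationary_distribution P $ y * P $ y $ x"
proof -
  show P: "irreducible_over E P"
    using assms by (simp add: W_rev_def)
  have "reversible P"
    using assms by (simp add: W_rev_def)
  then show "stationary_distribution P $ x * P $ x $ y = stationary_distribution P $ y * P $ y $ x"
    by (simp only: reversible_iff_detailed_balance[OF P])
qed

section \<open>Expectations under the edge measure\<close>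

text \<open>The sum runs over all pairs so that its variables can be exchanged freely; pairs outside
  the edge set have weight \<open>0\<close>, whatever value \<open>f\<close> takes there.\<close>

definition edge_expectation :: "real^'x^'x \<Rightarrow> ('x \<Rightarrow> 'x \<Rightarrow> real) \<Rightarrow> real" where
  "edge_expectation P f = (\<Sum>x\<in>UNIV. \<Sum>y\<in>UNIV. stationary_distribution P $ x * P $ x $ y * f x y)"

lemma edge_expectation_cong:
  assumes "irreducible_over E P" and "\<And>x y. (x, y) \<in> E \<Longrightarrow> f x y = g x y"
  shows "edge_expectation P f = edge_expectation P g"
proof -
  have "w * P $ x $ y * f x y = w * P $ x $ y * g x y" for w x y
    using assms irreducible_overD(2,5)[OF assms(1), of x y] by (cases "P $ x $ y = 0") auto
  then show ?thesis
    by (simp only: edge_expectation_def)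
qed

lemma edge_expectation_add:
  "edge_expectation P (\<lambda>x y. f x y + g x y) = edge_expectation P f + edge_expectation P g"
  by (simp add: edge_expectation_def sum.distrib distrib_left)

lemma edge_expectation_diff:
  "edge_expectation P (\<lambda>x y. f x y - g x y) = edge_expectation P f - edge_expectation P g"
  by (simp add: edge_expectation_def sum_subtractf right_diff_distrib)

lemma edge_expectation_const:
  fixes P :: "real^'x::finite^'x"
  assumes P: "irreducible_over E P"
  shows "edge_expectation P (\<lambda>x y. c) = c"
  by (simp add: edge_expectation_def irreducible_overD[OF P] stationary_distribution[OF P]
      flip: sum_distrib_right sum_distrib_left)

text \<open>Both marginals of the edge measure are the stationary distribution: the first by the row
  sums, the second by stationarity.\<close>

lemma edge_expectation_coboundary:
  fixes P :: "real^'x::finite^'x"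
  assumes P: "irreducible_over E P"
  shows "edge_expectation P (\<lambda>x y. h y - h x) = 0"
proof -
  have "edge_expectation P (\<lambda>x y. h y) =
      (\<Sum>y\<in>UNIV. (\<Sum>x\<in>UNIV. stationary_distribution P $ x * P $ x $ y) * h y)"
    unfolding edge_expectation_def by (subst sum.swap) (simp add: sum_distrib_right)
  also have "\<dots> = (\<Sum>x\<in>UNIV. stationary_distribution P $ x * (\<Sum>y\<in>UNIV. P $ x $ y) * h x)"
    by (simp add: irreducible_overD[OF P] stationary_distribution[OF P])
  also have "\<dots> = edge_expectation P (\<lambda>x y. h x)"
    by (simp add: edge_expectation_def sum_distrib_left sum_distrib_right)
  finally show ?thesis
    by (simp add: edge_expectation_diff)
qed

text \<open>Detailed balance says that the edge measure is symmetric.\<close>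

lemma edge_expectation_swap:
  fixes P :: "real^'x::finite^'x"
  assumes "P \<in> W_rev E"
  shows "edge_expectation P (\<lambda>x y. f y x) = edge_expectation P f"
  unfolding edge_expectation_def by (subst sum.swap) (simp add: W_revD(2)[OF assms])

section \<open>Positivity of the divergence and unique minimizers\<close>

lemma divergence_eq:
  fixes P :: "real^'x::finite^'x"
  assumes P: "irreducible_over E P" and "irreducible_over F Q" and "E \<subseteq> F"
  shows "divergence P Q = ereal (edge_expectation P (\<lambda>x y. ln (P $ x $ y / Q $ x $ y)))"
proof -
  have "P $ x $ y = 0" if "(x, y) \<notin> E" for x y
    using that irreducible_overD(2,5)[OF P, of x y] by simp
  then have "edge_expectation P (\<lambda>x y. ln (P $ x $ y / Q $ x $ y)) =
      (\<Sum>(x, y)\<in>E. stationary_distribution P $ x * P $ x $ y * ln (P $ x $ y / Q $ x $ y))"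
    unfolding edge_expectation_def sum.cartesian_product
    by (intro sum.mono_neutral_right) auto
  then show ?thesis
    using assms(3) by (simp add: divergence_def irreducible_overD(4)[OF P] irreducible_overD(4)[OF assms(2)])
qed

lemma
  fixes P :: "real^'x::finite^'x"
  assumes P: "irreducible_over E P" and Q: "irreducible_over F Q" and "E \<subseteq> F"
  shows divergence_nonneg: "0 \<le> divergence P Q"
    and divergence_eq_0_iff: "divergence P Q = 0 \<longleftrightarrow> P = Q"
proof -
  let ?p = "stationary_distribution P"
  \<comment> \<open>The correction \<open>- P + Q\<close> sums to \<open>0\<close> over each row, so
    it leaves the divergence unchanged while making every single term non-negative. Outside
    \<open>E\<close> the term reduces to \<open>Q $ x $ y\<close>.\<close>
  define k where "k x y = P $ x $ y * ln (P $ x $ y / Q $ x $ y) - P $ x $ y + Q $ x $ y" for x y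
  note p_pos = stationary_distribution(1)[OF P]
  have k: "0 \<le> k x y \<and> (k x y = 0 \<longrightarrow> P $ x $ y = Q $ x $ y)" for x y
  proof (cases "(x, y) \<in> E")
    case True
    then have pos: "0 < P $ x $ y" "0 < Q $ x $ y"
      using assms irreducible_overD(5) by blast+
    define u where "u = Q $ x $ y / P $ x $ y"
    have "0 < u"
      using pos by (simp add: u_def)
    \<comment> \<open>In this form the sign and the equality case are those of
      \<open>ln u \<le> u - 1\<close>.\<close>
    have "k x y = P $ x $ y * (u - 1 - ln u)"
      using pos by (simp add: k_def u_def ln_div field_simps)
    moreover have "ln u \<le> u - 1"
      using \<open>0 < u\<close> by (rule ln_le_minus_one)
    moreover have "u = 1" if "ln u = u - 1"
      using \<open>0 < u\<close> that by (rule ln_eq_minus_one)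
    ultimately show ?thesis
      using pos by (auto simp: u_def)
  next
    case False
    then have "P $ x $ y = 0"
      using irreducible_overD(2,5)[OF P, of x y] by simp
    then show ?thesis
      using irreducible_overD(2)[OF Q, of x y] by (simp add: k_def)
  qed
  define K where "K x = ?p $ x * (\<Sum>y\<in>UNIV. k x y)" for x
  have K_nonneg: "0 \<le> K x" for x
    using k p_pos[of x] by (simp add: K_def sum_nonneg less_imp_le)
  have "K x = (\<Sum>y\<in>UNIV. ?p $ x * P $ x $ y * ln (P $ x $ y / Q $ x $ y))" for x
    by (simp add: K_def k_def sum.distrib sum_subtractf sum_distrib_left mult.assoc
        irreducible_overD(3)[OF P] irreducible_overD(3)[OF Q])
  then have div: "divergence P Q = ereal (\<Sum>x\<in>UNIV. K x)"
    by (simp add: divergence_eq[OF assms] edge_expectation_def)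
  then show "0 \<le> divergence P Q"
    by (simp add: sum_nonneg K_nonneg)
  show "divergence P Q = 0 \<longleftrightarrow> P = Q"
  proof
    assume "divergence P Q = 0"
    then have K_0: "K x = 0" for x
      using div K_nonneg by (simp add: sum_nonneg_eq_0_iff)
    have "(\<Sum>y\<in>UNIV. k x y) = 0" for x
      using K_0[of x] p_pos[of x] by (simp add: K_def)
    then have "k x y = 0" for x y
      using k by (simp add: sum_nonneg_eq_0_iff)
    then show "P = Q"
      using k by (simp add: vec_eq_iff)
  next
    assume "P = Q"
    then have "k x y = 0" for x y
      by (simp add: k_def)
    then show "divergence P Q = 0"
      using div by (simp add: K_def)
  qed
qed

lemma divergence_finite:
  fixes P :: "real^'x::finite^'x"
  assumes "irreducible_over E P" "irreducible_over F Q" "E \<subseteq> F"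
  shows "\<bar>divergence P Q\<bar> \<noteq> \<infinity>"
  by (simp add: divergence_eq[OF assms])

text \<open>Turns a Pythagorean identity into a unique minimizer, with \<open>g\<close> the
  remaining divergence. Finiteness of \<open>f a\<close> ensures that adding a positive
  \<open>g x\<close> strictly increases it.\<close>

lemma is_arg_min_unique:
  fixes f :: "'a \<Rightarrow> ereal"
  assumes "a \<in> S" and "\<bar>f a\<bar> \<noteq> \<infinity>"
    and "\<And>x. x \<in> S \<Longrightarrow> f x = f a + g x" "\<And>x. x \<in> S \<Longrightarrow> x \<noteq> a \<Longrightarrow> 0 < g x"
  shows "{x. is_arg_min f (\<lambda>x. x \<in> S) x} = {a}"
proof -
  have less: "f a < f x" if "x \<in> S" "x \<noteq> a" for x
    using assms(2) assms(3,4)[OF that(1)] that(2)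
    by (cases "f a"; cases "g x") auto
  then have "f a \<le> f x" if "x \<in> S" for x
    using that by (cases "x = a") (auto simp: less_imp_le)
  then show ?thesis
    using less assms(1) by (auto simp: is_arg_min_def not_less[symmetric])
qed

section \<open>The m-projection\<close>

lemma strongly_connected_mono: "strongly_connected E \<Longrightarrow> E \<subseteq> F \<Longrightarrow> strongly_connected F"
  unfolding strongly_connected_def using rtrancl_mono[of E F] by blast

lemma m_projection:
  fixes P Q :: "real^'x::finite^'x"
  assumes P: "irreducible_over E P"
  defines "M \<equiv> (1 / 2) *\<^sub>R (P + time_reversal P)"
  shows m_projection_in_W_rev: "M \<in> W_rev (E \<union> E\<inverse>)"
    and m_projection_pythagoras: "Q \<in> W_rev (E \<union> E\<inverse>) \<Longrightarrow>
      divergence P Q = divergence P M + divergence M Q"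
proof -
  let ?p = "stationary_distribution P"
  let ?F = "E \<union> E\<inverse>"
  note PD = irreducible_overD[OF P]
  note p = stationary_distribution[OF P]
  note p_nz = p(1)[THEN less_imp_neq, symmetric]
  have M: "M $ x $ y = (P $ x $ y + ?p $ y * P $ y $ x / ?p $ x) / 2" for x y
    by (simp add: M_def time_reversal_def)
  \<comment> \<open>The right-hand side is symmetric, so \<open>?p\<close> satisfies detailed
    balance for \<open>M\<close>; hence \<open>M\<close> is reversible and shares the stationary
    distribution of \<open>P\<close>.\<close>
  have pM: "?p $ x * M $ x $ y = (?p $ x * P $ x $ y + ?p $ y * P $ y $ x) / 2" for x y
    using p_nz[of x] by (simp add: M field_simps)
  have M_row: "(\<Sum>y\<in>UNIV. M $ x $ y) = 1" for x
    using p_nz[of x]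
    by (simp add: M sum.distrib PD p flip: sum_divide_distrib)
  have M_nonneg: "0 \<le> M $ x $ y" for x y
    using p(1) PD(2) by (simp add: M less_imp_le)
  have M_edges: "edges M = ?F"
  proof -
    have "0 < M $ x $ y \<longleftrightarrow> 0 < P $ x $ y \<or> 0 < P $ y $ x" for x y
    proof -
      have "0 < ?p $ y * P $ y $ x / ?p $ x \<longleftrightarrow> 0 < P $ y $ x"
        "0 \<le> ?p $ y * P $ y $ x / ?p $ x"
        using p(1)[of x] p(1)[of y] PD(2)[of y x] by (simp_all add: zero_less_mult_iff zero_less_divide_iff)
      then show ?thesis
        using PD(2)[of x y] unfolding M by (cases "P $ x $ y = 0") auto
    qed
    then show ?thesis
      by (auto simp: edges_def PD)
  qed
  have M_irr: "irreducible_over ?F M"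
    using M_row M_nonneg M_edges strongly_connected_mono[OF PD(1)]
    by (auto simp: irreducible_over_def row_stochastic_def)
  show M_rev: "M \<in> W_rev ?F"
    by (rule W_revI[OF M_irr, of "\<lambda>x. ?p $ x"]) (simp_all add: p pM)
  have M_stat: "stationary_distribution M $ x = ?p $ x" for x
    using stationary_of_detailed_balance[OF M_irr, of "\<lambda>x. ?p $ x"] by (simp add: pM p)
  show "divergence P Q = divergence P M + divergence M Q" if Q: "Q \<in> W_rev ?F"
  proof -
    let ?q = "stationary_distribution Q"
    note Q_irr = W_revD(1)[OF Q]
    note q = stationary_distribution(1)[OF Q_irr]
    define f where "f x y = ln (M $ x $ y / Q $ x $ y)" for x y
    \<comment> \<open>Taking logarithms of detailed balance for \<open>M\<close> and for
      \<open>Q\<close> and subtracting shows that this is the potential of the antisymmetric part of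
      \<open>f\<close>.\<close>
    define h where "h x = ln (?p $ x) - ln (?q $ x)" for x
    have f_swap: "f x y - f y x = h y - h x" if "(x, y) \<in> E" for x y
    proof -
      have pos: "0 < M $ x $ y" "0 < M $ y $ x" "0 < Q $ x $ y" "0 < Q $ y $ x"
        using that irreducible_overD(5)[OF M_irr] irreducible_overD(5)[OF Q_irr] by auto
      have "?p $ x * M $ x $ y = ?p $ y * M $ y $ x" "?q $ x * Q $ x $ y = ?q $ y * Q $ y $ x"
        by (simp_all add: pM W_revD(2)[OF Q])
      then have "ln (?p $ x * M $ x $ y) = ln (?p $ y * M $ y $ x)"
        "ln (?q $ x * Q $ x $ y) = ln (?q $ y * Q $ y $ x)"
        by simp_all
      then show ?thesis
        using pos p(1) q by (simp add: f_def h_def ln_div ln_mult p_nz q[THEN less_imp_neq, symmetric])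
    qed
    have "edge_expectation M f =
        (edge_expectation P f + edge_expectation P (\<lambda>x y. f y x)) / 2"
    proof -
      have "edge_expectation P (\<lambda>x y. f y x) = (\<Sum>x\<in>UNIV. \<Sum>y\<in>UNIV. ?p $ y * P $ y $ x * f x y)"
        unfolding edge_expectation_def by (rule sum.swap)
      moreover have "edge_expectation M f = (\<Sum>x\<in>UNIV. \<Sum>y\<in>UNIV.
          (?p $ x * P $ x $ y * f x y + ?p $ y * P $ y $ x * f x y) / 2)"
        by (simp add: edge_expectation_def M_stat pM distrib_right)
      ultimately show ?thesis
        by (simp add: edge_expectation_def sum.distrib add_divide_distrib flip: sum_divide_distrib)
    qed
    moreover have "edge_expectation P (\<lambda>x y. f x y - f y x) = 0"
      using edge_expectation_cong[OF P f_swap] edge_expectation_coboundary[OF P] by simp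
    ultimately have Mf: "edge_expectation M f = edge_expectation P f"
      by (simp add: edge_expectation_diff)
    \<comment> \<open>Splitting the log-ratio at \<open>M\<close> is legitimate on \<open>E\<close>,
      where all three kernels are positive. The \<open>f\<close> part can then be moved from
      \<open>P\<close> to \<open>M\<close> by \<open>Mf\<close>.\<close>
    have "edge_expectation P (\<lambda>x y. ln (P $ x $ y / Q $ x $ y)) =
        edge_expectation P (\<lambda>x y. ln (P $ x $ y / M $ x $ y) + f x y)"
    proof (rule edge_expectation_cong[OF P])
      fix x y assume "(x, y) \<in> E"
      then have "0 < P $ x $ y" "0 < M $ x $ y" "0 < Q $ x $ y"
        using PD(5) irreducible_overD(5)[OF M_irr] irreducible_overD(5)[OF Q_irr] by auto
      then show "ln (P $ x $ y / Q $ x $ y) = ln (P $ x $ y / M $ x $ y) + f x y"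
        by (simp add: f_def ln_div)
    qed
    then show ?thesis
      by (simp add: divergence_eq[OF P M_irr] divergence_eq[OF P Q_irr] divergence_eq[OF M_irr Q_irr]
          edge_expectation_add flip: Mf f_def)
  qed
qed

section \<open>The e-projection\<close>

text \<open>The assumption \<open>nonempty\<close> feeds the Perron-Frobenius lemmas: strong
  connectivity by itself also holds for the empty graph on one vertex, whose matrix has no positive
  root.\<close>

lemma e_projection:
  fixes P Q :: "real^'x::finite^'x"
  assumes P: "irreducible_over E P" and conn: "strongly_connected (E \<inter> E\<inverse>)"
    and nonempty: "E \<inter> E\<inverse> \<noteq> {}"
  defines "M \<equiv> stochastic_rescaling (\<chi> x y. sqrt (P $ x $ y * time_reversal P $ x $ y))"
  shows e_projection_in_W_rev: "M \<in> W_rev (E \<inter> E\<inverse>)"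
    and e_projection_pythagoras: "Q \<in> W_rev (E \<inter> E\<inverse>) \<Longrightarrow>
      divergence Q P = divergence Q M + divergence M P"
proof -
  let ?p = "stationary_distribution P"
  let ?F = "E \<inter> E\<inverse>"
  define A :: "real^'x^'x" where "A = (\<chi> x y. sqrt (P $ x $ y * time_reversal P $ x $ y))"
  define v where "v = pf_eigenvector A"
  define r where "r = pf_root A"
  note PD = irreducible_overD[OF P]
  note p = stationary_distribution[OF P]
  note p_nz = p(1)[THEN less_imp_neq, symmetric]
  have A: "A $ x $ y = sqrt (P $ x $ y * (?p $ y * P $ y $ x / ?p $ x))" for x y
    by (simp add: A_def time_reversal_def)
  have A_nonneg: "0 \<le> A $ x $ y" for x y
    using p(1) PD(2) by (simp add: A less_imp_le)
  have A_pos: "0 < A $ x $ y \<longleftrightarrow> (x, y) \<in> ?F" for x y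
    using p(1)[of x] p(1)[of y] PD(2)[of x y] PD(2)[of y x]
    by (auto simp: A zero_less_mult_iff zero_less_divide_iff simp flip: PD(5))
  have A_edges: "edges A = ?F"
    by (auto simp: edges_def A_pos)
  have r: "0 < r" and v: "\<And>x. 0 < v $ x" and eig: "A *v v = r *s v"
    using pf_eigenvector[of A] A_nonneg A_edges conn nonempty by (auto simp: r_def v_def)
  have M: "M $ x $ y = A $ x $ y * v $ y / (r * v $ x)" for x y
    by (simp add: M_def stochastic_rescaling_def v_def r_def flip: A_def)
  have M_row: "(\<Sum>y\<in>UNIV. M $ x $ y) = 1" for x
  proof -
    have "(\<Sum>y\<in>UNIV. M $ x $ y) = (A *v v) $ x / (r * v $ x)"
      by (simp add: M matrix_vector_mult_def sum_divide_distrib)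
    then show ?thesis
      using eig r v[of x] by simp
  qed
  have M_nonneg: "0 \<le> M $ x $ y" for x y
    using A_nonneg v r by (simp add: M less_imp_le)
  have M_pos: "0 < M $ x $ y \<longleftrightarrow> (x, y) \<in> ?F" for x y
    using v[of x] v[of y] r by (simp add: M A_pos pos_less_divide_eq zero_less_mult_iff)
  have M_irr: "irreducible_over ?F M"
    using M_row M_nonneg M_pos conn
    by (auto simp: irreducible_over_def row_stochastic_def edges_def)
  \<comment> \<open>Absorbing \<open>?p $ x\<close> into the root as its square cancels the
    denominator and leaves a symmetric radicand.\<close>
  have pA: "?p $ x * A $ x $ y = sqrt (?p $ x * ?p $ y * P $ x $ y * P $ y $ x)" for x y
  proof -
    have "?p $ x * A $ x $ y = sqrt ((?p $ x)\<^sup>2) * sqrt (P $ x $ y * (?p $ y * P $ y $ x / ?p $ x))"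
      using p(1)[of x] by (simp only: A real_sqrt_abs abs_of_pos)
    also have "\<dots> = sqrt ((?p $ x)\<^sup>2 * (P $ x $ y * (?p $ y * P $ y $ x / ?p $ x)))"
      by (rule real_sqrt_mult[symmetric])
    also have "(?p $ x)\<^sup>2 * (P $ x $ y * (?p $ y * P $ y $ x / ?p $ x)) =
        ?p $ x * ?p $ y * P $ x $ y * P $ y $ x"
      using p_nz[of x] by (simp add: field_simps power2_eq_square)
    finally show ?thesis .
  qed
  show M_rev: "M \<in> W_rev ?F"
    \<comment> \<open>As \<open>A(x,x')\<close> is \<open>sqrt (\<pi>(x') / \<pi>(x))\<close> times a symmetric function, \<open>\<pi> A\<close> is symmetric.\<close>
  proof (rule W_revI[OF M_irr, of "\<lambda>x. ?p $ x * (v $ x)\<^sup>2"])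
    show "0 < ?p $ x * (v $ x)\<^sup>2" for x
      using p(1)[of x] v[of x] by simp
    \<comment> \<open>The square in the weight turns the rescaling factor
      \<open>v $ y / v $ x\<close> into the symmetric product \<open>v $ x * v $ y\<close>.\<close>
    have pM: "?p $ x * (v $ x)\<^sup>2 * M $ x $ y = (?p $ x * A $ x $ y) * (v $ x * v $ y) / r" for x y
      using v[of x] r by (simp add: M power2_eq_square)
    have "?p $ x * A $ x $ y = ?p $ y * A $ y $ x" for x y
      unfolding pA by (simp only: mult_ac)
    then show "?p $ x * (v $ x)\<^sup>2 * M $ x $ y = ?p $ y * (v $ y)\<^sup>2 * M $ y $ x" for x y
      unfolding pM by (metis mult.commute)
  qed
  have div_diff: "divergence Q P = divergence Q M + ereal (- ln r)" if Q: "Q \<in> W_rev ?F" for Q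
  proof -
    note Q_irr = W_revD(1)[OF Q]
    \<comment> \<open>Half the logarithm of the edge measure of \<open>P\<close>: on
      \<open>?F\<close>, \<open>ln A - ln P\<close> is exactly the antisymmetric expression
      \<open>g y x - g x y\<close>.\<close>
    define g where "g x y = ln (?p $ x * P $ x $ y) / 2" for x y
    have "edge_expectation Q (\<lambda>x y. ln (Q $ x $ y / P $ x $ y)) =
        edge_expectation Q (\<lambda>x y. ln (Q $ x $ y / M $ x $ y) + ((g y x - g x y) +
          ((ln (v $ y) - ln (v $ x)) + - ln r)))"
    proof (rule edge_expectation_cong[OF Q_irr])
      fix x y assume "(x, y) \<in> ?F"
      then have pos: "0 < P $ x $ y" "0 < P $ y $ x" "0 < M $ x $ y" "0 < Q $ x $ y" "0 < A $ x $ y"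
        using PD(5) M_pos A_pos irreducible_overD(5)[OF Q_irr] by auto
      have "ln (A $ x $ y) = g y x - g x y + ln (P $ x $ y)"
        using pos p(1)[of x] p(1)[of y] by (simp add: A g_def ln_sqrt ln_mult ln_div field_simps)
      then have "ln (M $ x $ y) = g y x - g x y + ln (P $ x $ y) + ln (v $ y) - ln r - ln (v $ x)"
        using pos r v[of x] v[of y] by (simp add: M ln_mult ln_div)
      then show "ln (Q $ x $ y / P $ x $ y) = ln (Q $ x $ y / M $ x $ y) + ((g y x - g x y) +
          ((ln (v $ y) - ln (v $ x)) + - ln r))"
        using pos by (simp add: ln_div)
    qed
    \<comment> \<open>Symmetry of the edge measure of \<open>Q\<close> kills the \<open>g\<close>
      part, and the logarithms of \<open>v\<close> form a coboundary; only the constant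
      survives.\<close>
    also have "\<dots> = edge_expectation Q (\<lambda>x y. ln (Q $ x $ y / M $ x $ y)) - ln r"
      by (simp only: edge_expectation_add edge_expectation_diff[of Q "\<lambda>x y. g y x" g]
          edge_expectation_swap[OF Q, of g] edge_expectation_coboundary[OF Q_irr]
          edge_expectation_const[OF Q_irr])
    finally show ?thesis
      by (simp add: divergence_eq[OF Q_irr P] divergence_eq[OF Q_irr M_irr])
  qed
  \<comment> \<open>Taking \<open>M\<close> itself for \<open>Q\<close> in \<open>div_diff\<close>
    identifies the constant \<open>- ln r\<close> as \<open>divergence M P\<close>.\<close>
  have "divergence M M = 0"
    by (simp add: divergence_eq_0_iff[OF M_irr M_irr])
  then show "divergence Q P = divergence Q M + divergence M P" if "Q \<in> W_rev ?F"
    using div_diff[OF that] div_diff[OF M_rev] by simp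
qed

section \<open>Both projections as unique minimizers\<close>

theorem theorem6p1:
  fixes E :: "('x::finite \<times> 'x) set"
    and P Pm Pe :: "real^'x^'x"
  assumes "CARD('x) \<ge> 2"
    and "strongly_connected E"
    and "irreducible_over E P"
    and "Pm = (1 / 2) *\<^sub>R (P + time_reversal P)"
    and "Pe = stochastic_rescaling (\<chi> x x'. sqrt (P $ x $ x' * time_reversal P $ x $ x'))"
  shows
    "({Q. is_arg_min (\<lambda>R. divergence P R) (\<lambda>R. R \<in> W_rev (E \<union> E\<inverse>)) Q} = {Pm} \<and>
      (\<forall>Q \<in> W_rev (E \<union> E\<inverse>). divergence P Q = divergence P Pm + divergence Pm Q)) \<and>
     (strongly_connected (E \<inter> E\<inverse>) \<longrightarrow>
      {Q. is_arg_min (\<lambda>R. divergence R P) (\<lambda>R. R \<in> W_rev (E \<inter> E\<inverse>)) Q} = {Pe} \<and>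
      (\<forall>Q \<in> W_rev (E \<inter> E\<inverse>). divergence Q P = divergence Q Pe + divergence Pe P))"
proof (intro conjI impI)
  note P = assms(3)
  have Pm: "Pm \<in> W_rev (E \<union> E\<inverse>)"
    unfolding assms(4) by (rule m_projection_in_W_rev[OF P])
  show m: "\<forall>Q \<in> W_rev (E \<union> E\<inverse>). divergence P Q = divergence P Pm + divergence Pm Q"
    unfolding assms(4) using m_projection_pythagoras[OF P] by blast
  show "{Q. is_arg_min (\<lambda>R. divergence P R) (\<lambda>R. R \<in> W_rev (E \<union> E\<inverse>)) Q} = {Pm}"
    using Pm divergence_finite[OF P W_revD(1)[OF Pm]]
  proof (rule is_arg_min_unique)
    show "0 < divergence Pm Q" if Q: "Q \<in> W_rev (E \<union> E\<inverse>)" "Q \<noteq> Pm" for Q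
      using divergence_nonneg[OF W_revD(1)[OF Pm] W_revD(1)[OF Q(1)]]
        divergence_eq_0_iff[OF W_revD(1)[OF Pm] W_revD(1)[OF Q(1)]] Q(2)
      by (auto simp: less_le)
  qed (use m in auto)
next
  note P = assms(3)
  assume conn: "strongly_connected (E \<inter> E\<inverse>)"
  \<comment> \<open>Two distinct states joined by a path force an edge, since the reflexive
    transitive closure of the empty relation is the identity.\<close>
  have "\<not> CARD('x) \<le> Suc 0"
    using assms(1) by simp
  then obtain a b :: 'x where "a \<noteq> b"
    by (auto simp: card_le_Suc0_iff_eq)
  moreover have "(a, b) \<in> (E \<inter> E\<inverse>)\<^sup>*"
    using conn by (simp add: strongly_connected_def)
  ultimately have nonempty: "E \<inter> E\<inverse> \<noteq> {}"
    by (metis rtrancl_empty pair_in_Id_conv)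
  have Pe: "Pe \<in> W_rev (E \<inter> E\<inverse>)"
    unfolding assms(5) by (rule e_projection_in_W_rev[OF P conn nonempty])
  show e: "\<forall>Q \<in> W_rev (E \<inter> E\<inverse>). divergence Q P = divergence Q Pe + divergence Pe P"
    unfolding assms(5) using e_projection_pythagoras[OF P conn nonempty] by blast
  show "{Q. is_arg_min (\<lambda>R. divergence R P) (\<lambda>R. R \<in> W_rev (E \<inter> E\<inverse>)) Q} = {Pe}"
    using Pe divergence_finite[OF W_revD(1)[OF Pe] P]
  \<comment> \<open>Here the varying divergence \<open>divergence Q Pe\<close> stands first in the
    Pythagorean sum, so the summands are exchanged to match the rule.\<close>
  proof (rule is_arg_min_unique)
    show "0 < divergence Q Pe" if Q: "Q \<in> W_rev (E \<inter> E\<inverse>)" "Q \<noteq> Pe" for Q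
      using divergence_nonneg[OF W_revD(1)[OF Q(1)] W_revD(1)[OF Pe]]
        divergence_eq_0_iff[OF W_revD(1)[OF Q(1)] W_revD(1)[OF Pe]] Q(2)
      by (auto simp: less_le)
  qed (use e in \<open>auto simp: add.commute\<close>)
qed

end
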